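(* Let $\mathbb{K}$ be a field (or a division algebra) with an absolute value $|\cdot|:\mathbb{K}\to e^H\cup\{0\}$, where $H$ is a non-zero additive subgroup of $\mathbb{R}$, and let $V$ be a $\mathbb{K}$-vector space. Let $X$ be a non-empty set of norms on $V$ (with values in $e^H\cup\{0\}$) satisfying the following properties: (1) for every $\eta\in X$ and every $a\in H$, we have $e^a\eta\in X$; (2) for every $\eta,\eta'\in X$, there exists $a\in H$ such that $e^{-a}\eta'\leq\eta\leq e^a\eta'$; (3) $X$ is a join-semilattice in the following sense: for every non-empty subset $F\subset X$ such that there exists $\eta\in X$ with $\theta\leq\eta$ for all $\theta\in F$, the set $\{\eta'\in X \mid \theta\leq\eta' \text{ for all } \theta\in F\}$ has a unique minimum $\vee F\in X$. For $\eta,\eta'\in X$ define the Goldman-Iwahori distance $$d(\eta,\eta')=\sup_{v\in V\setminus\{0\}}\left|\log\frac{\eta(v)}{\eta'(v)}\right|.$$ Then the family of closed balls in the metric space $(X,d)$ satisfies the Helly property.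
   Context: A norm on $V$ is a map $\eta:V\to e^H\cup\{0\}$ such that $\eta(v)=0$ if and only if $v=0$; $\eta(\alpha v)=|\alpha|\eta(v)$ for all $\alpha\in\mathbb{K}$, $v\in V$; and $\eta(u+v)\leq\eta(u)+\eta(v)$ for all $u,v\in V$. Norms are partially ordered pointwise: $\eta\leq\eta'$ if $\eta(v)\leq\eta'(v)$ for all $v\in V$. The Helly property for a family of balls: any family (possibly infinite) of pairwise intersecting closed balls has a non-empty global intersection. *)

theory Defs
  imports "HOL-Analysis.Abstract_Metric_Spaces"
begin

(* The library locale vector_space is restricted to (commutative) fields, and the scalars here
   form a possibly noncommutative division ring. *)
locale left_vector_space =
  fixes smul :: "'k::division_ring \<Rightarrow> 'v::ab_group_add \<Rightarrow> 'v"
  assumes scale_right_distrib: "smul a (x + y) = smul a x + smul a y"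
    and scale_left_distrib: "smul (a + b) x = smul a x + smul b x"
    and scale_scale: "smul a (smul b x) = smul (a * b) x"
    and scale_one: "smul 1 x = x"

lemma left_vector_space_field_iff:
  fixes smul :: "'k::field \<Rightarrow> 'v::ab_group_add \<Rightarrow> 'v"
  shows "left_vector_space smul \<longleftrightarrow> vector_space smul"
  unfolding left_vector_space_def vector_space_def by blast

definition additive_subgroup :: "'a::group_add set \<Rightarrow> bool" where
  "additive_subgroup H \<longleftrightarrow> 0 \<in> H \<and> (\<forall>a\<in>H. \<forall>b\<in>H. a + b \<in> H) \<and> (\<forall>a\<in>H. - a \<in> H)"

definition exp_values :: "real set \<Rightarrow> real set" where
  "exp_values H = exp ` H \<union> {0}"

definition absolute_value :: "real set \<Rightarrow> ('k::division_ring \<Rightarrow> real) \<Rightarrow> bool" where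
  "absolute_value H av \<longleftrightarrow>
     (\<forall>x. av x \<in> exp_values H) \<and>
     (\<forall>x. av x = 0 \<longleftrightarrow> x = 0) \<and>
     (\<forall>x y. av (x * y) = av x * av y) \<and>
     (\<forall>x y. av (x + y) \<le> av x + av y)"

definition vs_norm ::
    "real set \<Rightarrow> ('k::division_ring \<Rightarrow> real) \<Rightarrow> ('k \<Rightarrow> 'v::ab_group_add \<Rightarrow> 'v) \<Rightarrow> ('v \<Rightarrow> real) \<Rightarrow> bool"
  where
  "vs_norm H av smul \<eta> \<longleftrightarrow>
     (\<forall>v. \<eta> v \<in> exp_values H) \<and>
     (\<forall>v. \<eta> v = 0 \<longleftrightarrow> v = 0) \<and>
     (\<forall>\<alpha> v. \<eta> (smul \<alpha> v) = av \<alpha> * \<eta> v) \<and>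
     (\<forall>u v. \<eta> (u + v) \<le> \<eta> u + \<eta> v)"

(* The element 0 only fixes the value of the supremum when the vector space is zero, since Sup {}
   is unspecified on the reals.  Outside X the value is 0 because the locale Metric_space requires
   symmetry and nonnegativity on the whole type. *)
definition goldman_iwahori_dist ::
    "('v::zero \<Rightarrow> real) set \<Rightarrow> ('v \<Rightarrow> real) \<Rightarrow> ('v \<Rightarrow> real) \<Rightarrow> real" where
  "goldman_iwahori_dist X \<eta> \<eta>' =
     (if \<eta> \<in> X \<and> \<eta>' \<in> X
      then Sup (insert 0 {\<bar>ln (\<eta> v / \<eta>' v)\<bar> | v. v \<noteq> 0})
      else 0)"

(* The ambient set M gives the intersection of the empty family its usual meaning. *)
definition helly_property :: "'a set \<Rightarrow> 'a set set \<Rightarrow> bool" where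
  "helly_property M \<C> \<longleftrightarrow>
     (\<forall>\<B>\<subseteq>\<C>. (\<forall>B\<in>\<B>. \<forall>B'\<in>\<B>. B \<inter> B' \<noteq> {}) \<longrightarrow> M \<inter> \<Inter>\<B> \<noteq> {})"

definition closed_balls :: "'a set \<Rightarrow> ('a \<Rightarrow> 'a \<Rightarrow> real) \<Rightarrow> 'a set set" where
  "closed_balls M d = {Metric_space.mcball M d x r | x r. x \<in> M \<and> 0 \<le> r}"

end

theory Submission
  imports Defs
begin

text \<open>
  The ball of radius \<open>a \<in> H\<close> around \<open>x\<close> is the order interval
  \<open>[e\<^sup>-\<^sup>a x, e\<^sup>a x]\<close> of \<open>X\<close>, and a family of pairwise intersecting
  intervals contains the join of its lower ends. A ball of arbitrary real radius \<open>r\<close> is the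
  intersection of the balls with the same centre whose radius lies in \<open>H\<close> and dominates every
  element of \<open>H\<close> below \<open>r\<close>: the logarithmic ratios of two norms lie in \<open>H\<close>, and \<open>H\<close> is either
  discrete or dense.
\<close>

section \<open>Additive subgroups of the real line\<close>

lemma additive_subgroup_diff:
  assumes "additive_subgroup H" "a \<in> H" "b \<in> H"
  shows "a - b \<in> H"
proof -
  have "a + - b \<in> H"
    using assms unfolding additive_subgroup_def by blast
  then show ?thesis by simp
qed

text \<open>The natural multiples of a positive element of \<open>H\<close> exceed every bound.
  Hence every ball lies in an interval whose radius belongs to \<open>H\<close>.\<close>

lemma additive_subgroup_unbounded:
  fixes H :: "real set"
  assumes H: "additive_subgroup H" and "H \<noteq> {0}"
  shows "\<exists>a\<in>H. r \<le> a"
proof -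
  have neg: "- a \<in> H" if "a \<in> H" for a
    using H that by (simp add: additive_subgroup_def)
  have "\<exists>h\<in>H. h \<noteq> 0"
    using assms by (auto simp: additive_subgroup_def)
  then obtain h where "h \<in> H" "h \<noteq> 0" by blast
  then obtain g where g: "g \<in> H" "g > 0"
    using neg by (cases "h > 0") force+
  have mult: "real n * g \<in> H" for n
    using H g by (induction n) (auto simp: additive_subgroup_def algebra_simps)
  obtain n where "r < real n * g"
    using reals_Archimedean3 [OF g(2)] by blast
  then show ?thesis
    using mult less_imp_le by blast
qed

text \<open>Either \<open>H\<close> meets the interval [r, t), and a point there serves, or that gap
  forces \<open>H\<close> to be discrete, and its largest element up to \<open>r\<close> serves. The
  lemma lets radii in \<open>H\<close> detect that a value of \<open>H\<close> exceeds
  \<open>r\<close>.\<close>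

lemma additive_subgroup_cut:
  fixes H :: "real set"
  assumes H: "additive_subgroup H" and r: "0 \<le> r" and t: "t \<in> H" "r < t"
  shows "\<exists>a\<in>H. a < t \<and> (\<forall>s\<in>H. s \<le> r \<longrightarrow> s \<le> a)"
proof (cases "\<exists>h\<in>H. r \<le> h \<and> h < t")
  case True
  then show ?thesis by fastforce
next
  case gap: False
  \<comment> \<open>Two elements of \<open>H\<close> closer than \<open>t - r\<close> would, on
    subtracting their difference from \<open>t\<close>, give an element of \<open>H\<close> inside
    the gap.\<close>
  have separated: "s - h \<ge> t - r" if "h \<in> H" "s \<in> H" "h < s" for h s
  proof (rule ccontr)
    assume "\<not> s - h \<ge> t - r"
    moreover have "t - (s - h) \<in> H"
      using H t that by (intro additive_subgroup_diff)
    ultimately show False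
      using gap that by force
  qed
  define S where "S = {h \<in> H. h \<le> r}"
  have "0 \<in> S" using H r by (simp add: S_def additive_subgroup_def)
  moreover have bdd: "bdd_above S" by (auto simp: S_def)
  \<comment> \<open>An element of \<open>S\<close> within \<open>t - r\<close> of the supremum is
    the maximum of \<open>S\<close>, since any larger one would overshoot \<open>Sup S\<close> by
    the separation.\<close>
  moreover have "Sup S - (t - r) < Sup S" using t by simp
  ultimately obtain h where h: "h \<in> S" "Sup S - (t - r) < h"
    using less_cSup_iff [of S] by blast
  have "s \<le> h" if "s \<in> H" "s \<le> r" for s
  proof (rule ccontr)
    assume "\<not> s \<le> h"
    then have "s - h \<ge> t - r"
      using separated h that by (simp add: S_def)
    moreover have "s \<le> Sup S"
      using that bdd by (simp add: S_def cSup_upper)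
    ultimately show False using h by linarith
  qed
  then show ?thesis
    using h t by (intro bexI [of _ h]) (auto simp: S_def)
qed

section \<open>Logarithms of ratios of norm values\<close>

lemma abs_ln_divide_le_iff:
  fixes p q :: real
  assumes "0 < p" "0 < q"
  shows "\<bar>ln (p / q)\<bar> \<le> a \<longleftrightarrow> exp (- a) * p \<le> q \<and> q \<le> exp a * p"
proof -
  have "\<bar>ln (p / q)\<bar> \<le> a \<longleftrightarrow> - a + ln p \<le> ln q \<and> ln q \<le> a + ln p"
    using assms by (auto simp: ln_div abs_le_iff)
  also have "\<dots> \<longleftrightarrow> ln (exp (- a) * p) \<le> ln q \<and> ln q \<le> ln (exp a * p)"
    using assms by (simp add: ln_mult)
  also have "\<dots> \<longleftrightarrow> exp (- a) * p \<le> q \<and> q \<le> exp a * p"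
    using assms by simp
  finally show ?thesis .
qed

lemma exp_values_pos_iff: "x \<in> exp_values H \<Longrightarrow> 0 < x \<longleftrightarrow> x \<noteq> 0"
  by (auto simp: exp_values_def)

text \<open>The logarithm of the ratio is a difference of two exponents in \<open>H\<close>, and
  \<open>H\<close> is closed under differences in either order.\<close>

lemma abs_ln_divide_exp_values:
  assumes H: "additive_subgroup H"
    and p: "p \<in> exp_values H" "p \<noteq> 0" and q: "q \<in> exp_values H" "q \<noteq> 0"
  shows "\<bar>ln (p / q)\<bar> \<in> H"
proof -
  obtain a b where ab: "a \<in> H" "b \<in> H" "p = exp a" "q = exp b"
    using p q by (auto simp: exp_values_def)
  then have "a - b \<in> H" "b - a \<in> H"
    using H by (simp_all add: additive_subgroup_diff)
  then show ?thesis
    using ab by (simp add: ln_div abs_if)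
qed

section \<open>The Goldman-Iwahori metric on pairwise comparable gauges\<close>

locale comparable_gauges =
  fixes X :: "('v::zero \<Rightarrow> real) set"
  assumes gauge_zero: "\<eta> \<in> X \<Longrightarrow> \<eta> 0 = 0"
    and gauge_pos: "\<eta> \<in> X \<Longrightarrow> v \<noteq> 0 \<Longrightarrow> 0 < \<eta> v"
    and comparable: "\<eta> \<in> X \<Longrightarrow> \<eta>' \<in> X \<Longrightarrow>
      \<exists>a. (\<lambda>v. exp (- a) * \<eta> v) \<le> \<eta>' \<and> \<eta>' \<le> (\<lambda>v. exp a * \<eta> v)"
begin

abbreviation "dist_GI \<equiv> goldman_iwahori_dist X"

text \<open>This translates the metric into the pointwise order. At \<open>v = 0\<close> both
  inequalities read 0 \<le> 0, so the restriction to nonzero vectors disappears.\<close>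

lemma abs_ln_le_iff:
  assumes "\<eta> \<in> X" "\<eta>' \<in> X"
  shows "(\<forall>v. v \<noteq> 0 \<longrightarrow> \<bar>ln (\<eta> v / \<eta>' v)\<bar> \<le> a) \<longleftrightarrow>
    (\<lambda>v. exp (- a) * \<eta> v) \<le> \<eta>' \<and> \<eta>' \<le> (\<lambda>v. exp a * \<eta> v)"
proof -
  have "(v \<noteq> 0 \<longrightarrow> \<bar>ln (\<eta> v / \<eta>' v)\<bar> \<le> a)
      \<longleftrightarrow> exp (- a) * \<eta> v \<le> \<eta>' v \<and> \<eta>' v \<le> exp a * \<eta> v" for v
    using assms by (cases "v = 0") (simp_all add: gauge_zero gauge_pos abs_ln_divide_le_iff)
  then show ?thesis
    by (simp only: le_fun_def all_conj_distrib)
qed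

text \<open>Comparability is what makes the supremum in the distance finite.\<close>

lemma bdd_above_abs_ln:
  assumes "\<eta> \<in> X" "\<eta>' \<in> X"
  shows "bdd_above (insert 0 {\<bar>ln (\<eta> v / \<eta>' v)\<bar> | v. v \<noteq> 0})"
proof -
  obtain a where "\<forall>v. v \<noteq> 0 \<longrightarrow> \<bar>ln (\<eta> v / \<eta>' v)\<bar> \<le> a"
    using comparable [OF assms] abs_ln_le_iff [OF assms] by blast
  then have "bdd_above {\<bar>ln (\<eta> v / \<eta>' v)\<bar> | v. v \<noteq> 0}"
    by (intro bdd_aboveI [of _ a]) blast
  then show ?thesis by simp
qed

text \<open>The condition \<open>0 \<le> r\<close> takes care of the element 0 inserted into the
  supremum.\<close>

lemma dist_le_iff:
  assumes "\<eta> \<in> X" "\<eta>' \<in> X" "0 \<le> r"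
  shows "dist_GI \<eta> \<eta>' \<le> r \<longleftrightarrow> (\<forall>v. v \<noteq> 0 \<longrightarrow> \<bar>ln (\<eta> v / \<eta>' v)\<bar> \<le> r)"
proof -
  have "Sup (insert 0 {\<bar>ln (\<eta> v / \<eta>' v)\<bar> | v. v \<noteq> 0}) \<le> r
      \<longleftrightarrow> (\<forall>t\<in>insert 0 {\<bar>ln (\<eta> v / \<eta>' v)\<bar> | v. v \<noteq> 0}. t \<le> r)"
    using bdd_above_abs_ln [OF assms(1,2)] by (intro cSup_le_iff) simp_all
  then show ?thesis
    using assms unfolding goldman_iwahori_dist_def by auto
qed

lemma dist_nonneg: "0 \<le> dist_GI \<eta> \<eta>'"
proof (cases "\<eta> \<in> X \<and> \<eta>' \<in> X")
  case True
  then show ?thesis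
    using bdd_above_abs_ln by (simp add: goldman_iwahori_dist_def cSup_upper)
qed (auto simp: goldman_iwahori_dist_def)

lemma abs_ln_le_dist:
  assumes "\<eta> \<in> X" "\<eta>' \<in> X" "v \<noteq> 0"
  shows "\<bar>ln (\<eta> v / \<eta>' v)\<bar> \<le> dist_GI \<eta> \<eta>'"
  using assms dist_le_iff [of \<eta> \<eta>' "dist_GI \<eta> \<eta>'"] dist_nonneg by blast

text \<open>In this form symmetry and the triangle inequality are inherited pointwise from the real
  line.\<close>

lemma abs_ln_divide:
  assumes "\<eta> \<in> X" "\<eta>' \<in> X" "v \<noteq> 0"
  shows "\<bar>ln (\<eta> v / \<eta>' v)\<bar> = \<bar>ln (\<eta> v) - ln (\<eta>' v)\<bar>"
  using gauge_pos [of \<eta> v] gauge_pos [of \<eta>' v] assms by (simp add: ln_div)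

lemma Metric_space_dist: "Metric_space X dist_GI"
proof
  fix x y
  show "0 \<le> dist_GI x y" by (rule dist_nonneg)
  show "dist_GI x y = dist_GI y x"
  proof (cases "x \<in> X \<and> y \<in> X")
    case True
    then have "\<bar>ln (x v / y v)\<bar> = \<bar>ln (y v / x v)\<bar>" if "v \<noteq> 0" for v
      using that by (simp add: abs_ln_divide abs_minus_commute)
    then have "{\<bar>ln (x v / y v)\<bar> | v. v \<noteq> 0} = {\<bar>ln (y v / x v)\<bar> | v. v \<noteq> 0}"
      by (intro Collect_cong) metis
    then show ?thesis
      using True by (simp add: goldman_iwahori_dist_def)
  qed (auto simp: goldman_iwahori_dist_def)
next
  fix x y
  assume xy: "x \<in> X" "y \<in> X"
  have "dist_GI x y = 0 \<longleftrightarrow> dist_GI x y \<le> 0"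
    using dist_nonneg [of x y] by linarith
  \<comment> \<open>For radius 0 both scaling factors are 1, so the order interval around
    \<open>x\<close> shrinks to \<open>x\<close>.\<close>
  also have "\<dots> \<longleftrightarrow> x \<le> y \<and> y \<le> x"
    using xy abs_ln_le_iff [OF xy, of 0] by (simp add: dist_le_iff)
  finally show "dist_GI x y = 0 \<longleftrightarrow> x = y" by auto
next
  fix x y z
  assume X: "x \<in> X" "y \<in> X" "z \<in> X"
  have "\<bar>ln (x v / z v)\<bar> \<le> dist_GI x y + dist_GI y z" if "v \<noteq> 0" for v
    using abs_ln_le_dist [of x y v] abs_ln_le_dist [of y z v] X that
    by (simp add: abs_ln_divide)
  then show "dist_GI x z \<le> dist_GI x y + dist_GI y z"
    using X dist_nonneg by (simp add: dist_le_iff)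
qed

section \<open>Closed balls as intersections of order intervals, and the Helly property\<close>

lemma mem_mcball_iff:
  assumes H: "additive_subgroup H" and range: "\<And>\<eta> v. \<eta> \<in> X \<Longrightarrow> \<eta> v \<in> exp_values H"
    and X: "x \<in> X" "y \<in> X" and r: "0 \<le> r"
  shows "y \<in> Metric_space.mcball X dist_GI x r \<longleftrightarrow>
    (\<forall>a\<in>H. (\<forall>s\<in>H. s \<le> r \<longrightarrow> s \<le> a) \<longrightarrow>
      (\<lambda>v. exp (- a) * x v) \<le> y \<and> y \<le> (\<lambda>v. exp a * x v))" (is "?L \<longleftrightarrow> ?R")
proof -
  have in_H: "\<bar>ln (x v / y v)\<bar> \<in> H" if "v \<noteq> 0" for v
    using that X gauge_pos [of x v] gauge_pos [of y v]
    by (intro abs_ln_divide_exp_values H range) simp_all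
  have "?L \<longleftrightarrow> (\<forall>v. v \<noteq> 0 \<longrightarrow> \<bar>ln (x v / y v)\<bar> \<le> r)"
    using X r by (simp add: Metric_space.in_mcball [OF Metric_space_dist] dist_le_iff)
  \<comment> \<open>A log ratio bounded by \<open>r\<close> is itself one of the \<open>s\<close>
    dominated by \<open>a\<close>. Conversely, a log ratio \<open>t > r\<close> lies in
    \<open>H\<close>, and the cut lemma yields an admissible \<open>a < t\<close>, which it
    violates.\<close>
  also have "\<dots> \<longleftrightarrow> (\<forall>a\<in>H. (\<forall>s\<in>H. s \<le> r \<longrightarrow> s \<le> a) \<longrightarrow>
      (\<forall>v. v \<noteq> 0 \<longrightarrow> \<bar>ln (x v / y v)\<bar> \<le> a))"
    using in_H additive_subgroup_cut [OF H r] by (meson linorder_not_le)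
  also have "\<dots> \<longleftrightarrow> ?R"
    by (simp only: abs_ln_le_iff [OF X])
  finally show ?thesis .
qed

lemma helly_closed_balls:
  assumes H: "additive_subgroup H" "H \<noteq> {0}"
    and "X \<noteq> {}" and range: "\<And>\<eta> v. \<eta> \<in> X \<Longrightarrow> \<eta> v \<in> exp_values H"
    and scale: "\<And>\<eta> a. \<eta> \<in> X \<Longrightarrow> a \<in> H \<Longrightarrow> (\<lambda>v. exp a * \<eta> v) \<in> X"
    and join: "\<And>F. F \<subseteq> X \<Longrightarrow> F \<noteq> {} \<Longrightarrow> (\<exists>\<eta>\<in>X. \<forall>\<theta>\<in>F. \<theta> \<le> \<eta>) \<Longrightarrow>
      \<exists>\<mu>\<in>X. (\<forall>\<theta>\<in>F. \<theta> \<le> \<mu>) \<and> (\<forall>\<eta>\<in>X. (\<forall>\<theta>\<in>F. \<theta> \<le> \<eta>) \<longrightarrow> \<mu> \<le> \<eta>)"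
  shows "helly_property X (closed_balls X dist_GI)"
  unfolding helly_property_def
proof (intro allI impI)
  fix \<B>
  assume \<B>: "\<B> \<subseteq> closed_balls X dist_GI"
    and meet: "\<forall>B\<in>\<B>. \<forall>B'\<in>\<B>. B \<inter> B' \<noteq> {}"
  have mem_iff: "y \<in> Metric_space.mcball X dist_GI x r \<longleftrightarrow>
    (\<forall>a\<in>H. (\<forall>s\<in>H. s \<le> r \<longrightarrow> s \<le> a) \<longrightarrow>
      (\<lambda>v. exp (- a) * x v) \<le> y \<and> y \<le> (\<lambda>v. exp a * x v))"
    if "x \<in> X" "y \<in> X" "0 \<le> r" for x y r
    using H(1) range that by (rule mem_mcball_iff)
  \<comment> \<open>\<open>P\<close> lists centre and radius of all intervals coming from all
    presentations of the given balls; \<open>F\<close> collects their lower ends.\<close>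
  define P where "P = {(x, a). x \<in> X \<and> a \<in> H \<and>
    (\<exists>r\<ge>0. Metric_space.mcball X dist_GI x r \<in> \<B> \<and> (\<forall>s\<in>H. s \<le> r \<longrightarrow> s \<le> a))}"
  define F where "F = (\<lambda>(x, a) v. exp (- a) * x v) ` P"
  \<comment> \<open>A point \<open>z\<close> common to the two balls lies above the lower end of the
    first interval and below the upper end of the second.\<close>
  have below: "(\<lambda>v. exp (- a) * x v) \<le> (\<lambda>v. exp b * y v)"
    if xa: "(x, a) \<in> P" and yb: "(y, b) \<in> P" for x a y b
  proof -
    obtain r where r: "r \<ge> 0" "Metric_space.mcball X dist_GI x r \<in> \<B>" "\<forall>s\<in>H. s \<le> r \<longrightarrow> s \<le> a"
      using xa by (auto simp: P_def)
    obtain r' where r': "r' \<ge> 0" "Metric_space.mcball X dist_GI y r' \<in> \<B>" "\<forall>s\<in>H. s \<le> r' \<longrightarrow> s \<le> b"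
      using yb by (auto simp: P_def)
    obtain z where z: "z \<in> Metric_space.mcball X dist_GI x r" "z \<in> Metric_space.mcball X dist_GI y r'"
      using meet r r' by blast
    then have "z \<in> X"
      by (simp add: Metric_space.in_mcball [OF Metric_space_dist])
    then have "(\<lambda>v. exp (- a) * x v) \<le> z" "z \<le> (\<lambda>v. exp b * y v)"
      using z r r' xa yb mem_iff unfolding P_def by blast+
    then show ?thesis by (rule order.trans)
  qed
  show "X \<inter> \<Inter>\<B> \<noteq> {}"
  proof (cases "\<B> = {}")
    case True
    then show ?thesis using \<open>X \<noteq> {}\<close> by simp
  next
    case False
    then obtain x r where xr: "x \<in> X" "r \<ge> 0" "Metric_space.mcball X dist_GI x r \<in> \<B>"
      using \<B> unfolding closed_balls_def by blast
    \<comment> \<open>Joins exist only for nonempty sets, so at least one admissible radius is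
      needed.\<close>
    obtain a where "a \<in> H" "r \<le> a"
      using additive_subgroup_unbounded [OF H] by blast
    then have xa: "(x, a) \<in> P"
      using xr by (force simp: P_def)
    have "F \<subseteq> X"
      using scale [of _ "- _"] H(1) by (auto simp: F_def P_def additive_subgroup_def)
    moreover have "F \<noteq> {}" using xa by (auto simp: F_def)
    \<comment> \<open>Every upper end bounds all of \<open>F\<close>, so the join \<mu> exists and,
      being least, lies below every upper end.\<close>
    moreover have upper: "\<forall>\<theta>\<in>F. \<theta> \<le> (\<lambda>v. exp b * y v)" if "(y, b) \<in> P" for y b
      using below that by (auto simp: F_def)
    moreover have scaled: "(\<lambda>v. exp b * y v) \<in> X" if "(y, b) \<in> P" for y b
      using that scale by (auto simp: P_def)
    ultimately obtain \<mu> where \<mu>: "\<mu> \<in> X" "\<And>\<theta>. \<theta> \<in> F \<Longrightarrow> \<theta> \<le> \<mu>"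
      and least: "\<And>\<eta>. \<eta> \<in> X \<Longrightarrow> \<forall>\<theta>\<in>F. \<theta> \<le> \<eta> \<Longrightarrow> \<mu> \<le> \<eta>"
      using join [of F] xa by blast
    have "\<mu> \<in> B" if B: "B \<in> \<B>" for B
    proof -
      obtain y s where ys: "y \<in> X" "s \<ge> 0" "B = Metric_space.mcball X dist_GI y s"
        using \<B> B unfolding closed_balls_def by blast
      have "(\<lambda>v. exp (- b) * y v) \<le> \<mu> \<and> \<mu> \<le> (\<lambda>v. exp b * y v)"
        if "b \<in> H" "\<forall>t\<in>H. t \<le> s \<longrightarrow> t \<le> b" for b
      proof -
        have yb: "(y, b) \<in> P"
          using that ys B by (auto simp: P_def)
        then have "(\<lambda>v. exp (- b) * y v) \<in> F"
          unfolding F_def by force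
        then show ?thesis
          using \<mu>(2) least [OF scaled [OF yb] upper [OF yb]] by blast
      qed
      then show ?thesis
        using ys \<mu>(1) mem_iff by simp
    qed
    then show ?thesis using \<mu>(1) by blast
  qed
qed

end

text \<open>The balls are those of a metric space, so the metric axioms for the distance are part of
  the conclusion.\<close>

theorem proposition1:
  fixes H :: "real set"
    and av :: "'k::division_ring \<Rightarrow> real"
    and smul :: "'k \<Rightarrow> 'v::ab_group_add \<Rightarrow> 'v"
    and X :: "('v \<Rightarrow> real) set"
  assumes "additive_subgroup H" and "H \<noteq> {0}"
    and "absolute_value H av"
    and "left_vector_space smul"
    and "X \<noteq> {}" and "\<And>\<eta>. \<eta> \<in> X \<Longrightarrow> vs_norm H av smul \<eta>"
    and "\<And>\<eta> a. \<eta> \<in> X \<Longrightarrow> a \<in> H \<Longrightarrow> (\<lambda>v. exp a * \<eta> v) \<in> X"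
    and "\<And>\<eta> \<eta>'. \<eta> \<in> X \<Longrightarrow> \<eta>' \<in> X \<Longrightarrow>
           \<exists>a\<in>H. (\<lambda>v. exp (- a) * \<eta>' v) \<le> \<eta> \<and> \<eta> \<le> (\<lambda>v. exp a * \<eta>' v)"
    and "\<And>F. F \<subseteq> X \<Longrightarrow> F \<noteq> {} \<Longrightarrow> (\<exists>\<eta>\<in>X. \<forall>\<theta>\<in>F. \<theta> \<le> \<eta>) \<Longrightarrow>
           \<exists>!\<mu>. \<mu> \<in> {\<eta>' \<in> X. \<forall>\<theta>\<in>F. \<theta> \<le> \<eta>'} \<and>
                (\<forall>\<eta>'\<in>{\<eta>' \<in> X. \<forall>\<theta>\<in>F. \<theta> \<le> \<eta>'}. \<mu> \<le> \<eta>')"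
  shows "Metric_space X (goldman_iwahori_dist X) \<and>
         helly_property X (closed_balls X (goldman_iwahori_dist X))"
proof -
  have val: "\<eta> v \<in> exp_values H" and zero: "\<eta> v = 0 \<longleftrightarrow> v = 0" if "\<eta> \<in> X" for \<eta> v
    using assms(6) [OF that] by (simp_all add: vs_norm_def)
  interpret comparable_gauges X
  proof
    fix \<eta> assume \<eta>: "\<eta> \<in> X"
    show "\<eta> 0 = 0" using zero [OF \<eta>] by simp
    show "0 < \<eta> v" if "v \<noteq> 0" for v
      using exp_values_pos_iff [OF val [OF \<eta>]] zero [OF \<eta>] that by blast
    \<comment> \<open>The comparability hypothesis scales its second norm, whence the exchanged
      roles of \<eta> and \<eta>'.\<close>
    show "\<exists>a. (\<lambda>v. exp (- a) * \<eta> v) \<le> \<eta>' \<and> \<eta>' \<le> (\<lambda>v. exp a * \<eta> v)" if "\<eta>' \<in> X" for \<eta>'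
      using assms(8) [OF that \<eta>] by blast
  qed
  have "helly_property X (closed_balls X (goldman_iwahori_dist X))"
  proof (rule helly_closed_balls [where H = H])
    show "additive_subgroup H" "H \<noteq> {0}" "X \<noteq> {}" by fact+
    show "\<eta> v \<in> exp_values H" if "\<eta> \<in> X" for \<eta> v
      using that by (rule val)
    show "(\<lambda>v. exp a * \<eta> v) \<in> X" if "\<eta> \<in> X" "a \<in> H" for \<eta> a
      using that by (rule assms(7))
    fix F assume "F \<subseteq> X" "F \<noteq> {}" "\<exists>\<eta>\<in>X. \<forall>\<theta>\<in>F. \<theta> \<le> \<eta>"
    from assms(9) [OF this]
    show "\<exists>\<mu>\<in>X. (\<forall>\<theta>\<in>F. \<theta> \<le> \<mu>) \<and> (\<forall>\<eta>\<in>X. (\<forall>\<theta>\<in>F. \<theta> \<le> \<eta>) \<longrightarrow> \<mu> \<le> \<eta>)"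
      by blast
  qed
  then show ?thesis
    using Metric_space_dist by blast
qed

end
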